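(* Let $A\in\mathbb{R}^{m\times c}$, $B\in\mathbb{R}^c$, and let $N_A\in\mathbb{R}^{c\times k}$ be a nullspace basis matrix of $A$, with $B_A= N_A^\top B$. A configuration $P\in\{0,1\}^c$ is feasible if and only if the linear program $$\min_{\nu\in\mathbb{R}^c}\ \Big(P-\tfrac12 1_c\Big)^\top\nu\quad\text{s.t.}\quad N_A^\top\nu=B_A,\quad \mathrm{diag}(P)\,\nu\ge 0,$$ is feasible.
   Context: Vector inequalities are element-wise and $1_c\in\mathbb{R}^c$ is the all-ones vector. A nullspace basis matrix of $A$ is a matrix $N_A\in\mathbb{R}^{c\times k}$, $k=\dim\ker A$, whose columns form a basis of $\{\lambda\in\mathbb{R}^c\mid A\lambda=0\}$. A configuration is a vector $P\in\{0,1\}^c$; $P_i=1$ means that the $i$-th constraint $A_i^\top u\le B_i$ ($A_i$ the $i$-th column of $A$) is enforced, and $P_i=0$ that it is disregarded. $\mathrm{diag}(P)$ is the diagonal matrix with $P$ on its diagonal. The configuration $P$ is feasible if the set $\mathcal{U}'(P)=\{u\in\mathbb{R}^m\mid \mathrm{diag}(P)A^\top u\le \mathrm{diag}(P)B\}$ is non-empty. A linear program is feasible if its constraints admit at least one solution. *)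

theory Defs
  imports "Jordan_Normal_Form.Matrix_Kernel"
begin

definition diag :: "real vec \<Rightarrow> real mat" where
  "diag v = mat_diag (dim_vec v) (\<lambda>i. v $ i)"

text \<open>The dimension \<open>k = kernel_dim A\<close> may be \<open>0\<close>. Distinctness is needed because
  \<open>set (cols N)\<close> forgets repeated columns.\<close>

definition nullspace_basis_matrix :: "real mat \<Rightarrow> real mat \<Rightarrow> bool" where
  "nullspace_basis_matrix A N \<longleftrightarrow>
     N \<in> carrier_mat (dim_col A) (kernel_dim A) \<and>
     distinct (cols N) \<and>
     kernel.basis (dim_col A) A (set (cols N))"

definition configuration :: "nat \<Rightarrow> real vec \<Rightarrow> bool" where
  "configuration c P \<longleftrightarrow> P \<in> carrier_vec c \<and> (\<forall>i<c. P $ i \<in> {0, 1})"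

definition enforced_set :: "real mat \<Rightarrow> real vec \<Rightarrow> real vec \<Rightarrow> real vec set" where
  "enforced_set A B P =
     {u \<in> carrier_vec (dim_row A). diag P *\<^sub>v (A\<^sup>T *\<^sub>v u) \<le> diag P *\<^sub>v B}"

definition feasible_configuration :: "real mat \<Rightarrow> real vec \<Rightarrow> real vec \<Rightarrow> bool" where
  "feasible_configuration A B P \<longleftrightarrow> enforced_set A B P \<noteq> {}"

text \<open>A record denotes the linear program of minimising \<open>cost \<bullet> x\<close> over the \<open>x\<close> with
  \<open>eq_mat *\<^sub>v x = eq_rhs\<close> and \<open>ge_mat *\<^sub>v x \<ge> ge_rhs\<close>; the number of unknowns is the
  dimension of \<open>cost\<close>. The order on vectors is element-wise.\<close>

record linear_program =
  cost :: "real vec"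
  eq_mat :: "real mat"
  eq_rhs :: "real vec"
  ge_mat :: "real mat"
  ge_rhs :: "real vec"

definition lp_feasible_set :: "linear_program \<Rightarrow> real vec set" where
  "lp_feasible_set L =
     {x \<in> carrier_vec (dim_vec (cost L)).
        eq_mat L *\<^sub>v x = eq_rhs L \<and> ge_mat L *\<^sub>v x \<ge> ge_rhs L}"

definition lp_feasible :: "linear_program \<Rightarrow> bool" where
  "lp_feasible L \<longleftrightarrow> lp_feasible_set L \<noteq> {}"

end

theory Submission
  imports Defs
begin

text \<open>Feasibility of \<open>P\<close> means \<open>diag P (B - A\<^sup>T u) \<ge> 0\<close> for some \<open>u\<close>, and \<open>\<nu> = B - A\<^sup>T u\<close> is the
  substitution that turns one problem into the other: the row space of \<open>A\<close> is the orthogonal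
  complement of its kernel, so \<open>B - \<nu>\<close> has the form \<open>A\<^sup>T u\<close> if and only if \<open>N\<^sup>T (B - \<nu>) = 0\<close>.\<close>

text \<open>One step of Gram-Schmidt: \<open>b\<close> is the part of \<open>a n\<close> orthogonal to its predecessors. The
  multiple \<open>t\<close> of \<open>b\<close> to be removed is also right for \<open>b = 0\<close>, when it is \<open>0 / 0 = 0\<close>.\<close>

lemma residual_orthogonal_exists:
  fixes a :: "nat \<Rightarrow> nat \<Rightarrow> real" and w :: "nat \<Rightarrow> real"
  shows "\<exists>u. \<forall>i<n. (\<Sum>k<c. a i k * (w k - (\<Sum>j<n. u j * a j k))) = 0"
proof (induction n arbitrary: w)
  case 0
  then show ?case by simp
next
  case (Suc n)
  obtain u where u: "\<And>i. i < n \<Longrightarrow> (\<Sum>k<c. a i k * (w k - (\<Sum>j<n. u j * a j k))) = 0"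
    using Suc.IH by blast
  \<comment> \<open>The induction hypothesis is needed for a second vector, the new row
    \<open>a n\<close>; this is why \<open>w\<close> is generalised.\<close>
  obtain s where s: "\<And>i. i < n \<Longrightarrow> (\<Sum>k<c. a i k * (a n k - (\<Sum>j<n. s j * a j k))) = 0"
    using Suc.IH by blast
  define z where "z k = w k - (\<Sum>j<n. u j * a j k)" for k
  define b where "b k = a n k - (\<Sum>j<n. s j * a j k)" for k
  define t where "t = (\<Sum>k<c. b k * z k) / (\<Sum>k<c. b k * b k)"
  \<comment> \<open>Collecting coefficients in \<open>z - t * b\<close>: each earlier row has
    \<open>s j\<close> in \<open>b\<close>, while \<open>a n\<close> itself has coefficient
    \<open>1\<close> there and so receives \<open>t\<close>.\<close>
  define u' where "u' j = (if j < n then u j - t * s j else t)" for j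
  define r where "r k = w k - (\<Sum>j<Suc n. u' j * a j k)" for k
  have r: "r k = z k - t * b k" for k
  proof -
    have "(\<Sum>j<n. u' j * a j k) = (\<Sum>j<n. u j * a j k) - t * (\<Sum>j<n. s j * a j k)"
      by (simp add: u'_def algebra_simps sum_subtractf sum_distrib_left)
    then show ?thesis
      by (simp add: r_def z_def b_def u'_def algebra_simps)
  qed
  have tb: "t * (\<Sum>k<c. b k * b k) = (\<Sum>k<c. b k * z k)"
  proof (cases "(\<Sum>k<c. b k * b k) = 0")
    case True
    then have "\<forall>k<c. b k = 0"
      by (subst (asm) sum_nonneg_eq_0_iff) auto
    then show ?thesis by simp
  qed (simp add: t_def)
  have old: "(\<Sum>k<c. a i k * r k) = 0" if "i < n" for i
  proof -
    have "(\<Sum>k<c. a i k * r k) = (\<Sum>k<c. a i k * z k) - t * (\<Sum>k<c. a i k * b k)"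
      by (simp add: r algebra_simps sum_subtractf sum_distrib_left)
    then show ?thesis
      using u[OF that] s[OF that] by (simp add: z_def b_def)
  qed
  \<comment> \<open>Splitting \<open>a n\<close> into \<open>b\<close> and a combination of the
    earlier rows leaves only the \<open>b\<close> part, by \<open>old\<close>; \<open>tb\<close> is
    the choice of \<open>t\<close> that cancels it.\<close>
  have "(\<Sum>k<c. a n k * r k) = (\<Sum>k<c. b k * r k) + (\<Sum>k<c. \<Sum>j<n. s j * (a j k * r k))"
    by (simp add: b_def algebra_simps sum.distrib[symmetric] sum_distrib_left)
  also have "(\<Sum>k<c. \<Sum>j<n. s j * (a j k * r k)) = (\<Sum>j<n. s j * (\<Sum>k<c. a j k * r k))"
    by (subst sum.swap) (simp add: sum_distrib_left)
  also have "\<dots> = 0"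
    using old by simp
  also have "(\<Sum>k<c. b k * r k) = (\<Sum>k<c. b k * z k) - t * (\<Sum>k<c. b k * b k)"
    by (simp add: r algebra_simps sum_subtractf sum_distrib_left)
  finally have "(\<Sum>k<c. a n k * r k) = 0"
    using tb by simp
  with old have "\<forall>i<Suc n. (\<Sum>k<c. a i k * r k) = 0"
    by (auto simp: less_Suc_eq)
  then show ?case
    unfolding r_def by blast
qed

text \<open>The number of rows of \<open>A\<^sup>T\<close> alone fixes the dimension of the product,
  so \<open>u\<close> may be arbitrary.\<close>

lemma transpose_mult_vec_carrier:
  assumes "A \<in> carrier_mat m c"
  shows "A\<^sup>T *\<^sub>v u \<in> carrier_vec c"
  using carrier_matD(2)[OF assms] by (intro carrier_vecI) simp

text \<open>With the rows of \<open>A\<close> as the family, orthogonality of the residual to each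
  row is exactly membership in the kernel.\<close>

lemma row_space_kernel_decomposition:
  fixes A :: "real mat"
  assumes A: "A \<in> carrier_mat m c" and w: "w \<in> carrier_vec c"
  obtains u where "u \<in> carrier_vec m" "w - A\<^sup>T *\<^sub>v u \<in> mat_kernel A"
proof -
  obtain f where f: "\<forall>i<m. (\<Sum>k<c. A $$ (i, k) * (w $ k - (\<Sum>j<m. f j * A $$ (j, k)))) = 0"
    using residual_orthogonal_exists[where a = "\<lambda>i k. A $$ (i, k)" and w = "\<lambda>k. w $ k" and n = m and c = c] by blast
  define u where "u = vec m f"
  have At: "(A\<^sup>T *\<^sub>v u) $ k = (\<Sum>j<m. f j * A $$ (j, k))" if "k < c" for k
    using A that by (auto simp: u_def scalar_prod_def atLeast0LessThan mult.commute intro!: sum.cong)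
  have "A *\<^sub>v (w - A\<^sup>T *\<^sub>v u) = 0\<^sub>v m"
  proof (rule eq_vecI)
    fix i assume "i < dim_vec (0\<^sub>v m :: real vec)"
    then have i: "i < m" by simp
    have "(A *\<^sub>v (w - A\<^sup>T *\<^sub>v u)) $ i = (\<Sum>k<c. A $$ (i, k) * (w $ k - (A\<^sup>T *\<^sub>v u) $ k))"
      using A w i by (auto simp: scalar_prod_def atLeast0LessThan intro!: sum.cong)
    also have "\<dots> = 0"
      using f i by (simp add: At)
    finally show "(A *\<^sub>v (w - A\<^sup>T *\<^sub>v u)) $ i = (0\<^sub>v m :: real vec) $ i"
      using i by simp
  qed (use A in simp)
  then have "w - A\<^sup>T *\<^sub>v u \<in> mat_kernel A"
    using transpose_mult_vec_carrier[OF A] w by (intro mat_kernelI[OF A] minus_carrier_vec)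
  moreover have "u \<in> carrier_vec m"
    by (simp add: u_def)
  ultimately show thesis
    using that by blast
qed

text \<open>One direction is the adjoint identity. For the other, the kernel component
  \<open>z\<close> of \<open>w\<close> is orthogonal to \<open>w\<close> by assumption and to the
  row space by the adjoint identity, hence to itself, and so vanishes.\<close>

lemma row_space_eq_orthogonal_kernel:
  fixes A :: "real mat"
  assumes A: "A \<in> carrier_mat m c" and w: "w \<in> carrier_vec c"
  shows "(\<exists>u\<in>carrier_vec m. w = A\<^sup>T *\<^sub>v u) \<longleftrightarrow> (\<forall>z\<in>mat_kernel A. w \<bullet> z = 0)"
proof
  assume "\<exists>u\<in>carrier_vec m. w = A\<^sup>T *\<^sub>v u"
  then show "\<forall>z\<in>mat_kernel A. w \<bullet> z = 0"
    using transpose_vec_mult_scalar[OF A] mat_kernelD[OF A] by auto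
next
  assume orth: "\<forall>z\<in>mat_kernel A. w \<bullet> z = 0"
  obtain u where u: "u \<in> carrier_vec m" and z: "w - A\<^sup>T *\<^sub>v u \<in> mat_kernel A"
    using row_space_kernel_decomposition[OF A w] .
  define z where "z = w - A\<^sup>T *\<^sub>v u"
  have Au: "A\<^sup>T *\<^sub>v u \<in> carrier_vec c"
    by (rule transpose_mult_vec_carrier[OF A])
  have zc: "z \<in> carrier_vec c" and Az: "A *\<^sub>v z = 0\<^sub>v m"
    using mat_kernelD[OF A z] by (auto simp: z_def)
  have "z \<bullet> z = w \<bullet> z - (A\<^sup>T *\<^sub>v u) \<bullet> z"
    using minus_scalar_prod_distrib[OF w Au zc] by (simp add: z_def)
  also have "\<dots> = 0"
    using orth z transpose_vec_mult_scalar[OF A zc u] Az u by (simp add: z_def)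
  finally have "\<forall>k<c. z $ k = 0"
    using zc by (auto simp: scalar_prod_def sum_nonneg_eq_0_iff)
  then have "w = A\<^sup>T *\<^sub>v u"
    using w A by (intro eq_vecI) (auto simp: z_def)
  then show "\<exists>u\<in>carrier_vec m. w = A\<^sup>T *\<^sub>v u"
    using u by blast
qed

text \<open>The entries of \<open>N\<^sup>T *\<^sub>v w\<close> are the inner products of
  \<open>w\<close> with the columns of \<open>N\<close>, and since these span the kernel,
  orthogonality extends to it by linearity.\<close>

lemma orthogonal_nullspace_basis_matrix:
  assumes A: "A \<in> carrier_mat m c" and N: "nullspace_basis_matrix A N"
    and w: "w \<in> carrier_vec c"
  shows "N\<^sup>T *\<^sub>v w = 0\<^sub>v (dim_col N) \<longleftrightarrow> (\<forall>z\<in>mat_kernel A. w \<bullet> z = 0)"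
proof -
  interpret kernel m c A
    by unfold_locales (rule A)
  have Nc: "N \<in> carrier_mat c (kernel_dim A)" and basis: "basis (set (cols N))"
    using N A by (auto simp: nullspace_basis_matrix_def)
  have sub: "set (cols N) \<subseteq> mat_kernel A" and span: "span (set (cols N)) = mat_kernel A"
    using basis by (auto simp: Ker.basis_def)
  have "N\<^sup>T *\<^sub>v w = 0\<^sub>v (dim_col N) \<longleftrightarrow> (\<forall>x\<in>set (cols N). w \<bullet> x = 0)"
    using Nc w by (auto simp: vec_eq_iff cols_def comm_scalar_prod[of w c])
  also have "\<dots> \<longleftrightarrow> (\<forall>z\<in>mat_kernel A. w \<bullet> z = 0)"
  proof
    assume orth: "\<forall>x\<in>set (cols N). w \<bullet> x = 0"
    show "\<forall>z\<in>mat_kernel A. w \<bullet> z = 0"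
    proof
      fix z assume z: "z \<in> mat_kernel A"
      \<comment> \<open>There are finitely many columns, so a single combination over the whole set
        represents \<open>z\<close>.\<close>
      then obtain f where f: "z = lincomb f (set (cols N))"
        using Ker.finite_in_span[OF _ sub] span by auto
      have zc: "z \<in> carrier_vec c"
        using mat_kernelD[OF A z] by simp
      have "w \<bullet> z = (\<Sum>k<c. \<Sum>x\<in>set (cols N). f x * (w $ k * x $ k))"
        using zc by (simp add: scalar_prod_def atLeast0LessThan f lincomb_index[OF _ sub]
            sum_distrib_left mult.left_commute)
      also have "\<dots> = (\<Sum>x\<in>set (cols N). f x * (w \<bullet> x))"
      proof (subst sum.swap, rule sum.cong)
        fix x assume "x \<in> set (cols N)"
        then have "x \<in> carrier_vec c"
          using sub mat_kernelD[OF A] by blast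
        then show "(\<Sum>k<c. f x * (w $ k * x $ k)) = f x * (w \<bullet> x)"
          by (simp add: scalar_prod_def atLeast0LessThan sum_distrib_left)
      qed simp
      also have "\<dots> = 0"
        using orth by simp
      finally show "w \<bullet> z = 0" .
    qed
  qed (use sub in blast)
  finally show ?thesis .
qed

lemma diag_mult_vec_index:
  assumes "i < dim_vec P" "dim_vec x = dim_vec P"
  shows "(diag P *\<^sub>v x) $ i = P $ i * x $ i"
  using assms
  by (simp add: diag_def mat_diag_def scalar_prod_def if_distrib[of "\<lambda>t. t * _"] cong: if_cong)

lemma dim_row_diag [simp]: "dim_row (diag P) = dim_vec P"
  by (simp add: diag_def mat_diag_def)

theorem theorem3:
  fixes m c :: nat
    and A N :: "real mat"
    and B B\<^sub>A P :: "real vec"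
  assumes "A \<in> carrier_mat m c"
    and "B \<in> carrier_vec c"
    and "nullspace_basis_matrix A N"
    and "B\<^sub>A = N\<^sup>T *\<^sub>v B"
    and "configuration c P"
  shows "feasible_configuration A B P \<longleftrightarrow>
    lp_feasible
      \<lparr> cost = P - (1 / 2) \<cdot>\<^sub>v vec c (\<lambda>_. 1),
        eq_mat = N\<^sup>T, eq_rhs = B\<^sub>A,
        ge_mat = diag P, ge_rhs = 0\<^sub>v c \<rparr>"
proof -
  note A = assms(1) and B = assms(2)
  have P: "P \<in> carrier_vec c"
    using assms(5) by (simp add: configuration_def)
  have N: "N \<in> carrier_mat c (dim_col N)"
    using assms(1,3) by (auto simp: nullspace_basis_matrix_def)
  have eq_iff: "N\<^sup>T *\<^sub>v \<nu> = B\<^sub>A \<longleftrightarrow> (\<exists>u\<in>carrier_vec m. B - \<nu> = A\<^sup>T *\<^sub>v u)"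
    if \<nu>: "\<nu> \<in> carrier_vec c" for \<nu>
  proof -
    have "N\<^sup>T *\<^sub>v (B - \<nu>) = B\<^sub>A - N\<^sup>T *\<^sub>v \<nu>"
      unfolding assms(4) using N B \<nu> by (intro mult_minus_distrib_mat_vec) auto
    then have "N\<^sup>T *\<^sub>v \<nu> = B\<^sub>A \<longleftrightarrow> N\<^sup>T *\<^sub>v (B - \<nu>) = 0\<^sub>v (dim_col N)"
      using assms(4) by (auto simp: vec_eq_iff)
    also have "\<dots> \<longleftrightarrow> (\<exists>u\<in>carrier_vec m. B - \<nu> = A\<^sup>T *\<^sub>v u)"
      using orthogonal_nullspace_basis_matrix[OF A assms(3)] row_space_eq_orthogonal_kernel[OF A] B \<nu>
      by simp
    finally show ?thesis .
  qed
  have ge_iff: "diag P *\<^sub>v (A\<^sup>T *\<^sub>v u) \<le> diag P *\<^sub>v B \<longleftrightarrow> diag P *\<^sub>v \<nu> \<ge> 0\<^sub>v c"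
    if \<nu>: "\<nu> \<in> carrier_vec c" "B - \<nu> = A\<^sup>T *\<^sub>v u" for \<nu> u
  proof -
    \<comment> \<open>Replacing \<open>A\<^sup>T *\<^sub>v u\<close> by \<open>B - \<nu>\<close>
      makes the terms \<open>P $ i * B $ i\<close> cancel.\<close>
    have "P $ i * (A\<^sup>T *\<^sub>v u) $ i \<le> P $ i * B $ i \<longleftrightarrow> 0 \<le> P $ i * \<nu> $ i" if "i < c" for i
      using that \<nu> B by (simp flip: \<nu>(2) add: right_diff_distrib)
    then show ?thesis
      using P A B \<nu>(1) by (simp add: less_eq_vec_def diag_mult_vec_index del: index_mult_mat_vec)
  qed
  have "feasible_configuration A B P \<longleftrightarrow>
      (\<exists>u\<in>carrier_vec m. diag P *\<^sub>v (A\<^sup>T *\<^sub>v u) \<le> diag P *\<^sub>v B)"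
    using A by (auto simp: feasible_configuration_def enforced_set_def)
  \<comment> \<open>Each \<open>u\<close> determines its \<open>\<nu>\<close>. Once both are
    quantified, \<open>u\<close> can be eliminated in favour of the equality constraint on
    \<open>\<nu>\<close>.\<close>
  also have "\<dots> \<longleftrightarrow> (\<exists>u\<in>carrier_vec m. \<exists>\<nu>\<in>carrier_vec c. B - \<nu> = A\<^sup>T *\<^sub>v u \<and> diag P *\<^sub>v \<nu> \<ge> 0\<^sub>v c)"
  proof (rule bex_cong[OF refl])
    fix u :: "real vec"
    define \<nu> where "\<nu> = B - A\<^sup>T *\<^sub>v u"
    have Au: "A\<^sup>T *\<^sub>v u \<in> carrier_vec c"
      by (rule transpose_mult_vec_carrier[OF A])
    have "\<nu> \<in> carrier_vec c" "B - \<nu> = A\<^sup>T *\<^sub>v u"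
      using Au B by (auto simp: \<nu>_def)
    then show "diag P *\<^sub>v (A\<^sup>T *\<^sub>v u) \<le> diag P *\<^sub>v B \<longleftrightarrow>
        (\<exists>\<nu>\<in>carrier_vec c. B - \<nu> = A\<^sup>T *\<^sub>v u \<and> diag P *\<^sub>v \<nu> \<ge> 0\<^sub>v c)"
      using ge_iff by blast
  qed
  also have "\<dots> \<longleftrightarrow> (\<exists>\<nu>\<in>carrier_vec c. N\<^sup>T *\<^sub>v \<nu> = B\<^sub>A \<and> diag P *\<^sub>v \<nu> \<ge> 0\<^sub>v c)"
    using eq_iff by blast
  \<comment> \<open>The number of unknowns is read off \<open>cost\<close>, whose dimension is
    \<open>c\<close>.\<close>
  also have "\<dots> \<longleftrightarrow> lp_feasible
      \<lparr> cost = P - (1 / 2) \<cdot>\<^sub>v vec c (\<lambda>_. 1),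
        eq_mat = N\<^sup>T, eq_rhs = B\<^sub>A,
        ge_mat = diag P, ge_rhs = 0\<^sub>v c \<rparr>"
    by (auto simp: lp_feasible_def lp_feasible_set_def)
  finally show ?thesis .
qed

end
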